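(* Let $S$ be a finite set of monomials in the base variables, and let $\mathcal{D}$ be a probability distribution over pairs $(\boldsymbol{x},y)\in\mathbb{R}^S\times\mathbb{R}$, where the coordinates of $\boldsymbol{x}$ are the values of the monomials in $S$ at the underlying base point. Let $\ell:\mathbb{R}\to\mathbb{R}$ be a twice differentiable convex loss with $\ell\ge 0$ and $\max\{|\ell'|,\ell''\}\le 1$, let $\lambda>0$, and define $$f(\boldsymbol{w}) := \mathbb{E}_{(\boldsymbol{x},y)\sim\mathcal{D}}\big[\ell(\langle \boldsymbol{w},\boldsymbol{x}y\rangle)\big]+\frac{\lambda}{2}\|\boldsymbol{w}\|^2 ,\qquad \boldsymbol{w}\in\mathbb{R}^S .$$ Let $(\boldsymbol{w}_t,\boldsymbol{g}_t)_{t\ge 1}$ be generated by the algorithm $\mathtt{apple}$ (described in the context) with step sizes $\eta_t := 1/(\lambda(t+1))$, where $\boldsymbol{g}_t$ is the stochastic gradient at $\boldsymbol{w}_t$ computed from the sample $(\boldsymbol{x}_t,y_t)\sim\mathcal{D}$, i.e. $\boldsymbol{g}_t=\ell'(\langle\boldsymbol{w}_t,\boldsymbol{x}_ty_t\rangle)\,\boldsymbol{x}_ty_t+\lambda\boldsymbol{w}_t$, so that $\mathbb{E}_t([\boldsymbol{g}_t]_{S_{(t)}})=[\nabla f(\boldsymbol{w}_t)]_{S_{(t)}}$, where $S_{(t)}$ is the feature set used by $\mathtt{apple}$ at time $t$. Let $X$ and $D$ be constants such that, almost surely, $X\ge\|\boldsymbol{x}_ty_t\|$ and $D\ge\max\{\|\boldsymbol{w}_t\|,\|\boldsymbol{u}_t\|\}$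 for all $t$. Then for any comparator sequence $(\boldsymbol{u}_t)_{t=1}^\infty$ with $\boldsymbol{u}_t\in S_{(t)}$ for all $t$ (and satisfying, almost surely, $\|\boldsymbol{u}_t\|\le D$ for all $t$), and any fixed $T\ge 1$, $$\mathbb{E}\left(f(\boldsymbol{w}_{T+1})-\frac{\sum_{t=1}^{T}(t+2)f(\boldsymbol{u}_t)}{\sum_{t=1}^{T}(t+2)}\right)\le\frac{1}{T+1}\left(\frac{(X^2+\lambda)(X+\lambda D)^2}{2\lambda^2}\right).$$
   Context: Norms and inner products are Euclidean on $\mathbb{R}^S$. For a subset $S'\subseteq S$ and $\boldsymbol{v}\in\mathbb{R}^S$, $[\boldsymbol{v}]_{S'}$ denotes the vector agreeing with $\boldsymbol{v}$ on the coordinates in $S'$ and zero on the other coordinates; "$\boldsymbol{u}\in S'$" means that $\boldsymbol{u}\in\mathbb{R}^S$ is supported on the coordinates in $S'$. The samples $(\boldsymbol{x}_t,y_t)$, $t\ge1$, are i.i.d. from $\mathcal{D}$, and $\mathbb{E}_t[\cdot]$ denotes conditional expectation given the data from rounds $1,\dots,t-1$. Algorithm $\mathtt{apple}$. Base variables are $x_1,\dots,x_d$. Inputs: initial feature set $S_1=\{x_1,\dots,x_d\}$, nonnegative integers $(s_k)_{k\ge1}$ (expansion sizes), increasing times $(\tau_k)_{k\ge1}$ (epoch schedule), step sizes $(\eta_t)_{t\ge1}$. Initialize $\boldsymbol{w}_1:=\boldsymbol{0}$, $k:=1$, $P_1:=\emptyset$. For $t=1,2,\dots$: receive a stochastic gradient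 $\boldsymbol{g}_t$; update $\boldsymbol{w}_{t+1}:=\boldsymbol{w}_t-\eta_t[\boldsymbol{g}_t]_{S_k}$; then, if $t=\tau_k$, let $M_k\subseteq S_k$ be the $s_k$ monomials in $S_k\setminus P_k$ (all of them if there are fewer than $s_k$) with largest weight magnitude in $\boldsymbol{w}_{t+1}$, set $S_{k+1}:=S_k\cup\{x_i\cdot m : 1\le i\le d,\ m\in M_k\}$ and $P_{k+1}:=P_k\cup M_k$, and increase $k$ by one. It is assumed that $S_1\subseteq S_2\subseteq\cdots\subseteq S$, where $S$ is a fixed finite set of monomials. Let $k_t$ be the value of the epoch index $k$ when the update at time $t$ is made; then $S_{(t)}:=S_{k_t}$. In particular $S_{(t)}\subseteq S_{(t+1)}$ and $S_{(t)}$ is determined by the data from rounds $1,\dots,t-1$. *)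

theory Defs
  imports "HOL-Probability.Probability" "HOL-Library.Multiset"
begin

text \<open>
  A monomial in the base variables \<open>x\<^sub>1, \<dots>, x\<^sub>d\<close> is the multiset of the indices of its factors:
  \<open>{#i#}\<close> is \<open>x\<^sub>i\<close> and \<open>add_mset i m\<close> is \<open>x\<^sub>i \<cdot> m\<close>.
\<close>

type_synonym monomial = "nat multiset"

definition monomial_value :: "(nat \<Rightarrow> real) \<Rightarrow> monomial \<Rightarrow> real" where
  "monomial_value b m = (\<Prod>j\<in>#m. b j)"

text \<open>
  Vectors in \<open>\<real>\<^sup>S\<close> have type \<open>real ^ 's\<close>, where a bijection \<open>mon\<close> from the finite index type \<open>'s\<close>
  onto \<open>S\<close> names the monomial that belongs to each coordinate.
\<close>

definition restrict_vec :: "('s \<Rightarrow> monomial) \<Rightarrow> monomial set \<Rightarrow> real ^ 's \<Rightarrow> real ^ 's" where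
  "restrict_vec mon S' v = (\<chi> i. if mon i \<in> S' then v $ i else 0)"

definition supported_on :: "('s \<Rightarrow> monomial) \<Rightarrow> monomial set \<Rightarrow> real ^ 's \<Rightarrow> bool" where
  "supported_on mon S' u \<longleftrightarrow> (\<forall>i. mon i \<notin> S' \<longrightarrow> u $ i = 0)"

text \<open>
  \<open>A\<close> consists of \<open>n\<close> elements of \<open>C\<close> (all of them if there are fewer) with largest weight
  magnitude in \<open>v\<close>. Ties may be broken in any way, so \<open>A\<close> need not be unique.
\<close>

definition largest_weights ::
  "('s \<Rightarrow> monomial) \<Rightarrow> real ^ 's \<Rightarrow> nat \<Rightarrow> monomial set \<Rightarrow> monomial set \<Rightarrow> bool" where
  "largest_weights mon v n C A \<longleftrightarrow>
     A \<subseteq> C \<and> card A = min n (card C) \<and>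
     (\<forall>i j. mon i \<in> A \<and> mon j \<in> C - A \<longrightarrow> \<bar>v $ j\<bar> \<le> \<bar>v $ i\<bar>)"

text \<open>
  The values of \<open>w\<^sub>t\<close>, \<open>k\<close>, \<open>S\<^sub>k\<close> and \<open>P\<^sub>k\<close> when the update at time \<open>t\<close> is made; in particular
  the field \<open>features\<close> of the state at time \<open>t\<close> is \<open>S\<^bsub>(t)\<^esub>\<close>.
\<close>

record ('s::finite) apple_state =
  weights :: "real ^ 's"
  epoch :: nat
  features :: "monomial set"
  expanded :: "monomial set"

definition apple_init :: "nat \<Rightarrow> ('s::finite) apple_state" where
  "apple_init d = \<lparr>weights = 0, epoch = 1, features = (\<lambda>i. {#i#}) ` {1..d}, expanded = {}\<rparr>"

text \<open>
  Round \<open>t\<close> of the algorithm on receiving the stochastic gradient \<open>g\<close>. It is a relation because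
  of the freedom to break ties.
\<close>

definition apple_step ::
  "('s::finite \<Rightarrow> monomial) \<Rightarrow> nat \<Rightarrow> (nat \<Rightarrow> nat) \<Rightarrow> (nat \<Rightarrow> nat) \<Rightarrow> (nat \<Rightarrow> real) \<Rightarrow>
   nat \<Rightarrow> real ^ 's \<Rightarrow> 's apple_state \<Rightarrow> 's apple_state \<Rightarrow> bool" where
  "apple_step mon d s \<tau> \<eta> t g \<sigma> \<sigma>' \<longleftrightarrow>
     weights \<sigma>' = weights \<sigma> - \<eta> t *\<^sub>R restrict_vec mon (features \<sigma>) g \<and>
     (if t = \<tau> (epoch \<sigma>) then
        \<exists>A. largest_weights mon (weights \<sigma>') (s (epoch \<sigma>)) (features \<sigma> - expanded \<sigma>) A \<and>
            features \<sigma>' = features \<sigma> \<union> {add_mset i m | i m. i \<in> {1..d} \<and> m \<in> A} \<and>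
            expanded \<sigma>' = expanded \<sigma> \<union> A \<and>
            epoch \<sigma>' = epoch \<sigma> + 1
      else
        features \<sigma>' = features \<sigma> \<and> expanded \<sigma>' = expanded \<sigma> \<and> epoch \<sigma>' = epoch \<sigma>)"

definition objective ::
  "((real ^ 's) \<times> real) measure \<Rightarrow> (real \<Rightarrow> real) \<Rightarrow> real \<Rightarrow> real ^ ('s::finite) \<Rightarrow> real" where
  "objective \<D> loss lam w = (\<integral>(x, y). loss (w \<bullet> (y *\<^sub>R x)) \<partial>\<D>) + lam / 2 * (norm w)\<^sup>2"

text \<open>The \<open>\<sigma>\<close>-algebra generated by the data \<open>z\<^sub>1, \<dots>, z\<^bsub>t-1\<^esub>\<close>.\<close>

definition past :: "'w measure \<Rightarrow> (nat \<Rightarrow> 'w \<Rightarrow> 'z::topological_space) \<Rightarrow> nat \<Rightarrow> 'w measure" where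
  "past M z t =
     vimage_algebra (space M) (\<lambda>\<omega>. \<lambda>r\<in>{1..<t}. z r \<omega>) (\<Pi>\<^sub>M r\<in>{1..<t}. borel)"

end

theory Submission
  imports Defs
begin

text \<open>
  Let \<open>m\<^sub>t\<close> be the infimum of \<open>f\<close> over the vectors supported on \<open>S\<^bsub>(t)\<^esub>\<close>. A step along the projected
  stochastic gradient satisfies, by smoothness of \<open>f\<close> with constant \<open>X\<^sup>2 + \<lambda>\<close> and the
  Polyak-Lojasiewicz inequality on \<open>S\<^bsub>(t)\<^esub>\<close>,
  \<open>E f(w\<^bsub>t+1\<^esub>) \<le> E f(w\<^sub>t) - 2 / (t + 1) \<cdot> E (f(w\<^sub>t) - m\<^sub>t) + C / (t + 1)\<^sup>2\<close>. Multiplying by \<open>t (t + 1)\<close>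
  and telescoping compares \<open>f(w\<^bsub>T+1\<^esub>)\<close> with the average of the \<open>m\<^sub>t\<close> for the weights \<open>t\<close>. Since the
  \<open>m\<^sub>t\<close> decrease, passing to the weights \<open>t + 2\<close> only increases the average, and \<open>m\<^sub>t \<le> f(u\<^sub>t)\<close>. Using
  \<open>m\<^sub>t\<close> instead of \<open>f(u\<^sub>t)\<close> in the recursion is essential: the \<open>f(u\<^sub>t)\<close> need not decrease, nor need \<open>u\<^sub>t\<close>
  be determined by the past.
\<close>

section \<open>Regularized risk\<close>

text \<open>Analysis of a single round at a fixed current point. A sample acts only through the
  vector \<open>V z\<close>, later instantiated with the label times the feature vector.\<close>

locale regularized_risk = prob_space N
  for N :: "'z measure" +
  fixes V :: "'z \<Rightarrow> 'e::euclidean_space"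
    and loss loss' loss'' :: "real \<Rightarrow> real"
    and lam X :: real
  assumes V_measurable [measurable]: "V \<in> borel_measurable N"
    and V_bound: "AE z in N. norm (V z) \<le> X"
    and loss_deriv: "(loss has_real_derivative loss' r) (at r)"
    and loss_deriv2: "(loss' has_real_derivative loss'' r) (at r)"
    and loss_convex: "convex_on UNIV loss"
    and loss_nonneg: "loss r \<ge> 0"
    and loss'_bound: "\<bar>loss' r\<bar> \<le> 1"
    and loss''_bound: "loss'' r \<le> 1"
    and lam_pos: "lam > 0"
begin

definition risk :: "'e \<Rightarrow> real" where
  "risk w = (\<integral>z. loss (w \<bullet> V z) \<partial>N) + lam / 2 * (norm w)\<^sup>2"

text \<open>The formula comes from formal differentiation under the integral. It is tied to
  \<open>risk\<close> by \<open>risk_smooth\<close> and \<open>risk_strongly_convex\<close>, which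
  integrate pointwise estimates.\<close>

definition grad :: "'e \<Rightarrow> 'e" where
  "grad w = (\<integral>z. loss' (w \<bullet> V z) *\<^sub>R V z \<partial>N) + lam *\<^sub>R w"

definition stoch_grad :: "'e \<Rightarrow> 'z \<Rightarrow> 'e" where
  "stoch_grad w z = loss' (w \<bullet> V z) *\<^sub>R V z + lam *\<^sub>R w"

lemma X_nonneg: "X \<ge> 0"
proof -
  have "AE z in N. 0 \<le> X"
    using V_bound by eventually_elim (use norm_ge_zero order_trans in blast)
  then show ?thesis
    by simp
qed

section \<open>Estimates for the scalar loss\<close>

lemma loss_continuous: "continuous_on UNIV loss"
  using loss_deriv by (meson DERIV_isCont continuous_at_imp_continuous_on)

lemma loss'_continuous: "continuous_on UNIV loss'"
  using loss_deriv2 by (meson DERIV_isCont continuous_at_imp_continuous_on)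

lemma loss_measurable [measurable]: "loss \<in> borel_measurable borel"
  using loss_continuous by (rule borel_measurable_continuous_onI)

lemma loss'_measurable [measurable]: "loss' \<in> borel_measurable borel"
  using loss'_continuous by (rule borel_measurable_continuous_onI)

lemma loss_lipschitz: "\<bar>loss a - loss b\<bar> \<le> \<bar>a - b\<bar>"
  using field_differentiable_bound[of UNIV loss loss' 1 b a] loss_deriv loss'_bound
  by (simp add: real_norm_def)

lemma loss_tangent: "loss a + loss' a * (b - a) \<le> loss b"
  using convex_on_imp_above_tangent[OF loss_convex, of a b "loss' a"] loss_deriv by simp

text \<open>Since \<open>loss''\<close> is at most 1, the function \<open>r^2 / 2 - loss r\<close>
  is convex, and its tangent at \<open>a\<close> gives the upper bound.\<close>

lemma loss_quadratic: "loss b \<le> loss a + loss' a * (b - a) + (b - a)\<^sup>2 / 2"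
proof -
  define q where "q r = r\<^sup>2 / 2 - loss r" for r
  have q1: "(q has_real_derivative (r - loss' r)) (at r)" for r
    unfolding q_def by (auto intro!: derivative_eq_intros loss_deriv)
  have q2: "((\<lambda>r. r - loss' r) has_real_derivative (1 - loss'' r)) (at r)" for r
    by (auto intro!: derivative_eq_intros loss_deriv2)
  have "convex_on UNIV q"
    by (rule f''_ge0_imp_convex[OF _ q1 q2]) (use loss''_bound in auto)
  from convex_on_imp_above_tangent[OF this, of a b "a - loss' a"] q1
  have "(a - loss' a) * (b - a) \<le> q b - q a"
    by simp
  then show ?thesis
    unfolding q_def by (simp add: power2_eq_square field_simps)
qed

section \<open>Integrability, stochastic gradients and quadratic bounds for the risk\<close>

lemma integrable_loss: "integrable N (\<lambda>z. loss (w \<bullet> V z))"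
proof (rule integrable_const_bound)
  show "AE z in N. norm (loss (w \<bullet> V z)) \<le> loss 0 + norm w * X"
    using V_bound
  proof eventually_elim
    case (elim z)
    have "\<bar>w \<bullet> V z\<bar> \<le> norm w * X"
      using Cauchy_Schwarz_ineq2[of w "V z"] elim
      by (meson mult_left_mono norm_ge_zero order_trans)
    then show ?case
      using loss_lipschitz[of "w \<bullet> V z" 0] loss_nonneg[of "w \<bullet> V z"] by simp
  qed
qed simp

lemma stoch_grad_bound: "AE z in N. norm (stoch_grad w z) \<le> X + lam * norm w"
  using V_bound
proof eventually_elim
  case (elim z)
  have "\<bar>loss' (w \<bullet> V z)\<bar> * norm (V z) \<le> 1 * X"
    using elim loss'_bound by (intro mult_mono) auto
  then show ?case
    unfolding stoch_grad_def using lam_pos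
    by (intro order_trans[OF norm_triangle_ineq]) simp
qed

lemma stoch_grad_measurable [measurable]: "stoch_grad w \<in> borel_measurable N"
  unfolding stoch_grad_def by measurable

lemma integrable_stoch_grad: "integrable N (stoch_grad w)"
  by (rule integrable_const_bound[OF stoch_grad_bound]) simp

lemma expectation_stoch_grad: "(\<integral>z. stoch_grad w z \<partial>N) = grad w"
proof -
  have "integrable N (\<lambda>z. stoch_grad w z - lam *\<^sub>R w)"
    using integrable_stoch_grad by simp
  then have "integrable N (\<lambda>z. loss' (w \<bullet> V z) *\<^sub>R V z)"
    by (simp add: stoch_grad_def)
  then show ?thesis
    unfolding stoch_grad_def grad_def by (simp add: prob_space)
qed

lemma risk_nonneg: "risk w \<ge> 0"
  unfolding risk_def using loss_nonneg lam_pos by (simp add: integral_nonneg_AE)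

text \<open>Evaluates the first-order terms of the pointwise expansions of \<open>loss\<close>. The
  regularizer's share of \<open>grad\<close> is taken off because the regularizer is expanded
  separately and exactly.\<close>

lemma integrable_loss'_inner: "integrable N (\<lambda>z. loss' (w \<bullet> V z) * (h \<bullet> V z))"
  and integral_loss'_inner: "(\<integral>z. loss' (w \<bullet> V z) * (h \<bullet> V z) \<partial>N) = grad w \<bullet> h - lam * (w \<bullet> h)"
proof -
  have eq: "loss' (w \<bullet> V z) * (h \<bullet> V z) = stoch_grad w z \<bullet> h - lam * (w \<bullet> h)" for z
    by (simp add: stoch_grad_def inner_add_left inner_commute[of h])
  show "integrable N (\<lambda>z. loss' (w \<bullet> V z) * (h \<bullet> V z))"
    unfolding eq using integrable_stoch_grad by simp
  show "(\<integral>z. loss' (w \<bullet> V z) * (h \<bullet> V z) \<partial>N) = grad w \<bullet> h - lam * (w \<bullet> h)"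
    unfolding eq using integrable_stoch_grad[of w]
    by (simp add: prob_space expectation_stoch_grad)
qed

text \<open>\<open>loss_quadratic\<close> is integrated with increment
  \<open>h \<bullet> V z\<close>, which Cauchy-Schwarz bounds by \<open>norm h * X\<close>. The
  regularizer is itself quadratic and contributes \<open>lam\<close>.\<close>

lemma risk_smooth: "risk (w + h) \<le> risk w + grad w \<bullet> h + (X\<^sup>2 + lam) / 2 * (norm h)\<^sup>2"
proof -
  have "(\<integral>z. loss ((w + h) \<bullet> V z) \<partial>N)
      \<le> (\<integral>z. loss (w \<bullet> V z) + loss' (w \<bullet> V z) * (h \<bullet> V z) + X\<^sup>2 * (norm h)\<^sup>2 / 2 \<partial>N)"
  proof (rule integral_mono_AE)
    show "AE z in N. loss ((w + h) \<bullet> V z)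
        \<le> loss (w \<bullet> V z) + loss' (w \<bullet> V z) * (h \<bullet> V z) + X\<^sup>2 * (norm h)\<^sup>2 / 2"
      using V_bound
    proof eventually_elim
      case (elim z)
      have "\<bar>h \<bullet> V z\<bar> \<le> norm h * X"
        using Cauchy_Schwarz_ineq2[of h "V z"] elim
        by (meson mult_left_mono norm_ge_zero order_trans)
      then have "(h \<bullet> V z)\<^sup>2 \<le> (norm h * X)\<^sup>2"
        using abs_le_square_iff by fastforce
      then show ?case
        using loss_quadratic[of "(w + h) \<bullet> V z" "w \<bullet> V z"]
        by (simp add: inner_add_left power_mult_distrib mult.commute)
    qed
  qed (use integrable_loss integrable_loss'_inner in auto)
  also have "\<dots> = (\<integral>z. loss (w \<bullet> V z) \<partial>N) + (grad w \<bullet> h - lam * (w \<bullet> h)) + X\<^sup>2 * (norm h)\<^sup>2 / 2"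
    using integrable_loss[of w] integrable_loss'_inner[of w h]
    by (simp add: prob_space integral_loss'_inner)
  finally show ?thesis
    unfolding risk_def by (simp add: dot_square_norm[symmetric] inner_simps inner_commute field_simps)
qed

text \<open>Convexity of \<open>loss\<close> supplies the linear lower bound; the curvature
  \<open>lam\<close> comes from the regularizer.\<close>

lemma risk_strongly_convex: "risk (w + h) \<ge> risk w + grad w \<bullet> h + lam / 2 * (norm h)\<^sup>2"
proof -
  have "(\<integral>z. loss (w \<bullet> V z) \<partial>N) + (grad w \<bullet> h - lam * (w \<bullet> h))
      = (\<integral>z. loss (w \<bullet> V z) + loss' (w \<bullet> V z) * (h \<bullet> V z) \<partial>N)"
    using integrable_loss[of w] integrable_loss'_inner[of w h]
    by (simp add: integral_loss'_inner)
  also have "\<dots> \<le> (\<integral>z. loss ((w + h) \<bullet> V z) \<partial>N)"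
  proof (rule integral_mono)
    show "loss (w \<bullet> V z) + loss' (w \<bullet> V z) * (h \<bullet> V z) \<le> loss ((w + h) \<bullet> V z)" for z
      using loss_tangent[of "w \<bullet> V z" "(w + h) \<bullet> V z"] by (simp add: inner_add_left)
  qed (intro Bochner_Integration.integrable_add integrable_loss integrable_loss'_inner)+
  finally show ?thesis
    unfolding risk_def by (simp add: dot_square_norm[symmetric] inner_simps inner_commute field_simps)
qed

lemma risk_upper: "risk w \<le> loss 0 + norm w * X + lam / 2 * (norm w)\<^sup>2"
proof -
  have "(\<integral>z. loss (w \<bullet> V z) \<partial>N) \<le> (\<integral>z. loss 0 + norm w * X \<partial>N)"
  proof (rule integral_mono_AE)
    show "AE z in N. loss (w \<bullet> V z) \<le> loss 0 + norm w * X"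
      using V_bound
    proof eventually_elim
      case (elim z)
      have "\<bar>w \<bullet> V z\<bar> \<le> norm w * X"
        using Cauchy_Schwarz_ineq2[of w "V z"] elim
        by (meson mult_left_mono norm_ge_zero order_trans)
      then show ?case
        using loss_lipschitz[of "w \<bullet> V z" 0] by simp
    qed
  qed (use integrable_loss in auto)
  then show ?thesis
    unfolding risk_def by (simp add: prob_space)
qed

text \<open>Supplies the dominating constants for integrability of the risk at random points of
  bounded norm.\<close>

lemma risk_bound:
  assumes "norm w \<le> B"
  shows "norm (risk w) \<le> loss 0 + B * X + lam / 2 * B\<^sup>2"
proof -
  have "norm w * X \<le> B * X" "(norm w)\<^sup>2 \<le> B\<^sup>2"
    using assms X_nonneg by (auto intro: mult_right_mono power_mono)
  moreover have "lam / 2 * (norm w)\<^sup>2 \<le> lam / 2 * B\<^sup>2"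
    using calculation lam_pos by simp
  ultimately show ?thesis
    using risk_upper[of w] risk_nonneg[of w] by simp
qed

lemma risk_measurable [measurable]: "risk \<in> borel_measurable borel"
  unfolding risk_def by measurable

section \<open>Infimum of the risk over a set of vectors\<close>

definition constrained_min :: "'e set \<Rightarrow> real" where
  "constrained_min U = (INF v\<in>U. risk v)"

lemma bdd_below_risk: "bdd_below (risk ` U)"
  using risk_nonneg by (auto intro!: bdd_belowI[of _ 0])

lemma constrained_min_le: "v \<in> U \<Longrightarrow> constrained_min U \<le> risk v"
  unfolding constrained_min_def by (rule cINF_lower[OF bdd_below_risk])

text \<open>Feature sets grow, and so do the sets of vectors supported on them; this makes the
  benchmarks of the final averaging decrease.\<close>

lemma constrained_min_antimono: "U \<subseteq> U' \<Longrightarrow> U \<noteq> {} \<Longrightarrow> constrained_min U' \<le> constrained_min U"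
  unfolding constrained_min_def by (intro cINF_superset_mono bdd_below_risk) auto

lemma constrained_min_nonneg: "U \<noteq> {} \<Longrightarrow> constrained_min U \<ge> 0"
  unfolding constrained_min_def by (rule cINF_greatest) (use risk_nonneg in auto)

text \<open>The zero vector is a test point of risk at most \<open>loss 0\<close>, whatever
  \<open>U\<close> is. The uniform bound makes the random benchmarks integrable.\<close>

lemma constrained_min_bound: "0 \<in> U \<Longrightarrow> norm (constrained_min U) \<le> loss 0"
proof -
  assume "0 \<in> U"
  then have "U \<noteq> {}"
    by blast
  then show ?thesis
    using constrained_min_le[OF \<open>0 \<in> U\<close>] constrained_min_nonneg[of U] risk_upper[of 0] by simp
qed

text \<open>
  Here \<open>R\<close> is an orthogonal projection. Minimising the strong convexity bound over the range of
  \<open>R\<close> gives a Polyak-Lojasiewicz inequality for the projected gradient.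
\<close>

lemma projected_PL:
  assumes R_inner: "\<And>a b. R a \<bullet> b = a \<bullet> R b"
    and R_range: "range R \<subseteq> U" "\<And>v. v \<in> U \<Longrightarrow> R v = v"
    and w: "w \<in> U" and diff: "\<And>a b. a \<in> U \<Longrightarrow> b \<in> U \<Longrightarrow> a - b \<in> U"
  shows "2 * lam * (risk w - constrained_min U) \<le> (norm (R (grad w)))\<^sup>2"
proof -
  have "risk w - (norm (R (grad w)))\<^sup>2 / (2 * lam) \<le> risk v" if v: "v \<in> U" for v
  proof -
    define h where "h = v - w"
    \<comment> \<open>\<open>h\<close> lies in \<open>U\<close> and is fixed by \<open>R\<close>, so
      self-adjointness replaces the gradient by its projection.\<close>
    have "grad w \<bullet> h = R (grad w) \<bullet> h"
      using diff[OF v w] R_range by (simp add: R_inner h_def)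
    \<comment> \<open>Completing the square: the quadratic in \<open>h\<close> on the right below is
      smallest at \<open>h = - R (grad w) / lam\<close>.\<close>
    moreover have "0 \<le> (norm (R (grad w) + lam *\<^sub>R h))\<^sup>2 / (2 * lam)"
      using lam_pos by simp
    then have "- (norm (R (grad w)))\<^sup>2 / (2 * lam) \<le> R (grad w) \<bullet> h + lam / 2 * (norm h)\<^sup>2"
      using lam_pos unfolding power2_norm_eq_inner
      by (simp add: inner_simps inner_commute field_simps power2_eq_square)
    ultimately show ?thesis
      using risk_strongly_convex[of w h] by (simp add: h_def)
  qed
  then have "risk w - (norm (R (grad w)))\<^sup>2 / (2 * lam) \<le> constrained_min U"
    unfolding constrained_min_def using w by (intro cINF_greatest) auto
  then show ?thesis
    using lam_pos by (simp add: field_simps)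
qed

text \<open>Smoothness is applied to the displacement along the projected stochastic gradient. Its
  linear term has mean \<open>- \<eta>\<close> times the squared norm of the projected gradient,
  which \<open>projected_PL\<close> converts into the gap to the infimum; the quadratic term is
  bounded almost surely.\<close>

lemma projected_step:
  assumes R_lin: "bounded_linear R"
    and R_inner: "\<And>a b. R a \<bullet> b = a \<bullet> R b"
    and R_range: "range R \<subseteq> U" "\<And>v. v \<in> U \<Longrightarrow> R v = v"
    and R_norm: "\<And>v. norm (R v) \<le> norm v"
    and w: "w \<in> U" and diff: "\<And>a b. a \<in> U \<Longrightarrow> b \<in> U \<Longrightarrow> a - b \<in> U"
    and B: "norm w \<le> B" and eta: "\<eta> \<ge> 0"
  shows "(\<integral>z. risk (w - \<eta> *\<^sub>R R (stoch_grad w z)) \<partial>N)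
    \<le> risk w - 2 * lam * \<eta> * (risk w - constrained_min U)
      + (X\<^sup>2 + lam) / 2 * \<eta>\<^sup>2 * (X + lam * B)\<^sup>2"
proof -
  interpret R: bounded_linear R by fact
  have [measurable]: "R \<in> borel_measurable borel"
    by (intro borel_measurable_continuous_onI linear_continuous_on R_lin)
  define G where "G = X + lam * B"
  have sg: "AE z in N. norm (R (stoch_grad w z)) \<le> G"
    using stoch_grad_bound[of w]
  proof eventually_elim
    case (elim z)
    have "lam * norm w \<le> lam * B"
      using B lam_pos by simp
    then show ?case
      using elim R_norm[of "stoch_grad w z"] unfolding G_def by linarith
  qed
  have int_R: "integrable N (\<lambda>z. R (stoch_grad w z))"
    by (rule integrable_bounded_linear[OF R_lin integrable_stoch_grad])
  have ev_R: "(\<integral>z. R (stoch_grad w z) \<partial>N) = R (grad w)"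
    using integral_bounded_linear[OF R_lin integrable_stoch_grad] by (simp add: expectation_stoch_grad)
  have "(\<integral>z. risk (w - \<eta> *\<^sub>R R (stoch_grad w z)) \<partial>N)
      \<le> (\<integral>z. risk w - \<eta> * (grad w \<bullet> R (stoch_grad w z)) + (X\<^sup>2 + lam) / 2 * \<eta>\<^sup>2 * G\<^sup>2 \<partial>N)"
  proof (rule integral_mono_AE)
    show "integrable N (\<lambda>z. risk (w - \<eta> *\<^sub>R R (stoch_grad w z)))"
    proof (rule integrable_const_bound)
      \<comment> \<open>The new point stays in the ball of radius \<open>B + \<eta> * G\<close>,
        where the risk is bounded.\<close>
      show "AE z in N. norm (risk (w - \<eta> *\<^sub>R R (stoch_grad w z)))
          \<le> loss 0 + (B + \<eta> * G) * X + lam / 2 * (B + \<eta> * G)\<^sup>2"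
        using sg
      proof eventually_elim
        case (elim z)
        have "norm (w - \<eta> *\<^sub>R R (stoch_grad w z)) \<le> norm w + \<eta> * norm (R (stoch_grad w z))"
          using norm_triangle_ineq4[of w "\<eta> *\<^sub>R R (stoch_grad w z)"] eta by simp
        also have "\<dots> \<le> B + \<eta> * G"
          using B elim eta by (intro add_mono mult_left_mono) auto
        finally show ?case
          by (rule risk_bound)
      qed
    qed simp
    show "AE z in N. risk (w - \<eta> *\<^sub>R R (stoch_grad w z))
        \<le> risk w - \<eta> * (grad w \<bullet> R (stoch_grad w z)) + (X\<^sup>2 + lam) / 2 * \<eta>\<^sup>2 * G\<^sup>2"
      using sg
    proof eventually_elim
      case (elim z)
      let ?h = "- \<eta> *\<^sub>R R (stoch_grad w z)"
      have "(norm ?h)\<^sup>2 \<le> \<eta>\<^sup>2 * G\<^sup>2"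
        using elim by (auto simp: power_mult_distrib intro!: mult_left_mono power_mono)
      then have "(X\<^sup>2 + lam) / 2 * (norm ?h)\<^sup>2 \<le> (X\<^sup>2 + lam) / 2 * (\<eta>\<^sup>2 * G\<^sup>2)"
        using lam_pos by (intro mult_left_mono) auto
      then show ?case
        using risk_smooth[of w ?h] by (simp add: mult.assoc)
    qed
  qed (use int_R in auto)
  also have "\<dots> = risk w - \<eta> * (grad w \<bullet> R (grad w)) + (X\<^sup>2 + lam) / 2 * \<eta>\<^sup>2 * G\<^sup>2"
    using int_R by (simp add: prob_space ev_R)
  \<comment> \<open>\<open>R\<close> is self-adjoint and fixes its own range, hence is
    idempotent.\<close>
  also have "grad w \<bullet> R (grad w) = (norm (R (grad w)))\<^sup>2"
    using R_range R_inner[of "grad w" "R (grad w)"]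
    by (simp add: power2_norm_eq_inner inner_commute range_subsetD)
  also have "risk w - \<eta> * (norm (R (grad w)))\<^sup>2 \<le> risk w - \<eta> * (2 * lam * (risk w - constrained_min U))"
    using projected_PL[OF R_inner R_range w diff] eta by (simp add: mult_left_mono)
  finally show ?thesis
    unfolding G_def by (simp add: algebra_simps)
qed

end

section \<open>Weighted averages\<close>

text \<open>At round \<open>t\<close> the factor \<open>t (t + 1) (1 - 2 / (t + 1))\<close> equals
  \<open>(t - 1) t\<close>, the factor from the previous round. It vanishes at \<open>t = 1\<close>,
  so the initial value drops out.\<close>

lemma weighted_recursion_bound:
  fixes a b :: "nat \<Rightarrow> real"
  assumes step: "\<And>t. t \<ge> 1 \<Longrightarrow>
      a (t + 1) \<le> a t - 2 / (real t + 1) * (a t - b t) + C / (real t + 1)\<^sup>2"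
    and C: "C \<ge> 0"
  shows "real T * (real T + 1) * a (T + 1) \<le> 2 * (\<Sum>t=1..T. real t * b t) + C * real T"
proof (induction T)
  case (Suc T)
  define n where "n = real T + 1"
  have n: "n > 0" by (simp add: n_def)
  have "a (Suc T + 1) \<le> a (Suc T) - 2 / (n + 1) * (a (Suc T) - b (Suc T)) + C / (n + 1)\<^sup>2"
    using step[of "Suc T"] by (simp add: n_def add_ac)
  then have "n * (n + 1) * a (Suc T + 1)
      \<le> n * (n + 1) * (a (Suc T) - 2 / (n + 1) * (a (Suc T) - b (Suc T)) + C / (n + 1)\<^sup>2)"
    using n by (intro mult_left_mono) auto
  also have "\<dots> = (n - 1) * n * a (Suc T) + 2 * n * b (Suc T) + C * (n / (n + 1))"
    using n by (simp add: divide_simps power2_eq_square) (simp add: algebra_simps)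
  \<comment> \<open>Each round adds noise at most \<open>C\<close>, which accounts for the term
    \<open>C * real T\<close>.\<close>
  also have "C * (n / (n + 1)) \<le> C"
    using C n by (intro mult_left_le) auto
  also have "(n - 1) * n * a (Suc T) \<le> 2 * (\<Sum>t=1..T. real t * b t) + C * real T"
    using Suc by (simp add: n_def)
  finally show ?case
    by (simp add: n_def algebra_simps)
qed simp

text \<open>
  The recursion naturally produces the weights \<open>t\<close>. As \<open>b\<close> decreases, Chebyshev's sum inequality
  replaces them by the flatter weights \<open>t + 2\<close>.
\<close>

lemma weighted_average_shift:
  fixes b :: "nat \<Rightarrow> real"
  assumes dec: "\<And>t. t \<ge> 1 \<Longrightarrow> b (t + 1) \<le> b t" and T: "T \<ge> 1"
  shows "2 * (\<Sum>t=1..T. real t * b t) / (real T * (real T + 1))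
    \<le> (\<Sum>t=1..T. real (t + 2) * b t) / (\<Sum>t=1..T. real (t + 2))"
proof -
  define P Q where "P = (\<Sum>t=1..T. real t * b t)" and "Q = (\<Sum>t=1..T. b t)"
  have antimono: "b j \<le> b i" if "i \<le> j" "i \<ge> 1" for i j
    using that(1) by (induction j rule: dec_induct) (use dec that(2) in \<open>auto intro: order_trans\<close>)
  have sum_t: "(\<Sum>t=1..T. real t) = real T * (real T + 1) / 2"
    by (induction T) (auto simp: field_simps)
  \<comment> \<open>The weights increase while \<open>b\<close> decreases. Indices are shifted to
    start at 0 to match \<open>Chebyshev_sum_upper\<close>.\<close>
  have "real T * (\<Sum>k=0..<T. real (Suc k) * b (Suc k))
      \<le> (\<Sum>k=0..<T. real (Suc k)) * (\<Sum>k=0..<T. b (Suc k))"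
    by (rule Chebyshev_sum_upper) (auto intro: antimono)
  moreover have "(\<Sum>k=0..<T. h (Suc k)) = (\<Sum>t=1..T. h t)" for h :: "nat \<Rightarrow> real"
    using sum.shift_bounds_Suc_ivl[of h 0 T] by (simp add: atLeastLessThanSuc_atLeastAtMost)
  note this[of "\<lambda>t. real t * b t"] this[of real] this[of b]
  ultimately have "real T * P \<le> (\<Sum>t=1..T. real t) * Q"
    unfolding P_def Q_def by (simp only:)
  then have "real T * P \<le> real T * ((real T + 1) / 2 * Q)"
    unfolding sum_t by simp
  then have PQ: "P \<le> (real T + 1) / 2 * Q"
    using T by simp
  have split1: "(\<Sum>t=1..T. real (t + 2) * b t) = P + 2 * Q"
    unfolding P_def Q_def by (simp add: sum.distrib sum_distrib_left algebra_simps)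
  have split2: "(\<Sum>t=1..T. real (t + 2)) = real T * (real T + 5) / 2"
    using sum_t by (simp add: sum.distrib field_simps)
  \<comment> \<open>After cross-multiplication \<open>P * (real T + 1)\<close> cancels, and
    \<open>4 * P \<le> 2 * (real T + 1) * Q\<close> remains, which is \<open>PQ\<close>.\<close>
  have "P / (real T + 1) \<le> (P + 2 * Q) / (real T + 5)"
    using PQ by (simp add: field_simps)
  from mult_left_mono[OF this, of "2 / real T"]
  have "2 * P / (real T * (real T + 1)) \<le> (P + 2 * Q) / (real T * (real T + 5) / 2)"
    by (simp add: mult.commute)
  then show ?thesis
    unfolding split1 split2 P_def .
qed

section \<open>Coordinate projections\<close>

lemma restrict_vec_bounded_linear: "bounded_linear (restrict_vec mon F :: real ^ 's::finite \<Rightarrow> _)"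
  unfolding linear_conv_bounded_linear[symmetric]
  by (rule linearI) (auto simp: restrict_vec_def vec_eq_iff)

lemma restrict_vec_inner:
  fixes a b :: "real ^ 's::finite"
  shows "restrict_vec mon F a \<bullet> b = a \<bullet> restrict_vec mon F b"
  unfolding inner_vec_def restrict_vec_def by (intro sum.cong) auto

lemma norm_restrict_vec_le: "norm (restrict_vec mon F v) \<le> norm (v :: real ^ 's::finite)"
  by (rule norm_le_componentwise_cart) (simp add: restrict_vec_def)

lemma supported_on_restrict_vec: "supported_on mon F (restrict_vec mon F v)"
  by (simp add: supported_on_def restrict_vec_def)

lemma restrict_vec_supported: "supported_on mon F v \<Longrightarrow> restrict_vec mon F v = v"
  by (auto simp: supported_on_def restrict_vec_def vec_eq_iff)

lemma supported_on_diff: "supported_on mon F a \<Longrightarrow> supported_on mon F b \<Longrightarrow> supported_on mon F (a - b)"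
  by (simp add: supported_on_def)

lemma supported_on_scaleR: "supported_on mon F a \<Longrightarrow> supported_on mon F (c *\<^sub>R a)"
  by (simp add: supported_on_def)

lemma supported_on_mono: "supported_on mon F v \<Longrightarrow> F \<subseteq> F' \<Longrightarrow> supported_on mon F' v"
  by (auto simp: supported_on_def)

text \<open>Lets the projection be recovered from the preimage of a feature set under
  \<open>mon\<close>: the image of that preimage is the set intersected with
  \<open>range mon\<close>.\<close>

lemma restrict_vec_Int_range: "restrict_vec mon (F \<inter> range mon) = restrict_vec mon F"
  by (auto simp: restrict_vec_def fun_eq_iff vec_eq_iff)

lemma restrict_vec_measurable [measurable]:
  "(restrict_vec mon F :: real ^ 's::finite \<Rightarrow> _) \<in> borel_measurable borel"
  by (intro borel_measurable_continuous_onI linear_continuous_on restrict_vec_bounded_linear)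

lemma apple_step_features_mono: "apple_step mon d s \<tau> \<eta> t g \<sigma> \<sigma>' \<Longrightarrow> features \<sigma> \<subseteq> features \<sigma>'"
  by (auto simp: apple_step_def split: if_splits)

section \<open>The past of an independent sequence\<close>

lemma space_past [simp]: "space (past M z t) = space M"
  by (simp add: past_def)

lemma past_measurable:
  assumes "r \<in> {1..<t}"
  shows "z r \<in> past M z t \<rightarrow>\<^sub>M borel"
proof -
  have "(\<lambda>\<omega>. \<lambda>r\<in>{1..<t}. z r \<omega>) \<in> past M z t \<rightarrow>\<^sub>M (\<Pi>\<^sub>M r\<in>{1..<t}. borel)"
    unfolding past_def by (rule measurable_vimage_algebra1) (auto simp: space_PiM)
  from measurable_compose[OF this measurable_component_singleton[OF assms]]
  show ?thesis
    using assms by simp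
qed

text \<open>\<open>N\<close> is kept general so that the result serves both for the whole space and
  for the past one round later.\<close>

lemma past_subalgebra:
  assumes "\<And>r. r \<in> {1..<t} \<Longrightarrow> z r \<in> N \<rightarrow>\<^sub>M borel" and "space N = space M"
  shows "subalgebra N (past M z t)"
  unfolding subalgebra_def
proof
  show "sets (past M z t) \<subseteq> sets N"
    unfolding past_def by (rule sets_image_in_sets[OF assms(2)]) (intro measurable_restrict assms(1))
qed (simp add: assms(2))

text \<open>Independence of the fresh sample from anything determined by the past, stated as a
  product law. An event about \<open>W\<close> is an event about the tuple of earlier data, and that
  tuple is independent of the sample because their index blocks are disjoint.\<close>

lemma (in prob_space) past_present_distr:
  assumes indep: "indep_vars (\<lambda>_. borel) z {1..}" and t: "t \<ge> 1"
    and W: "W \<in> past M z t \<rightarrow>\<^sub>M K"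
  shows "distr M K W \<Otimes>\<^sub>M distr M borel (z t) = distr M (K \<Otimes>\<^sub>M borel) (\<lambda>\<omega>. (W \<omega>, z t \<omega>))"
proof -
  define Z where "Z = (\<lambda>\<omega>. \<lambda>r\<in>{1..<t}. z r \<omega>)"
  \<comment> \<open>The single sample is wrapped as a one-coordinate family, the form in which
    \<open>indep_var_restrict\<close> gives independence of blocks.\<close>
  define Zt where "Zt = (\<lambda>\<omega>. \<lambda>r\<in>{t}. z r \<omega>)"
  have z: "random_variable borel (z r)" if "r \<ge> 1" for r
    using indep that by (auto simp: indep_vars_def)
  then have z_t [measurable]: "random_variable borel (z t)"
    using t by blast
  have "subalgebra M (past M z t)"
    by (rule past_subalgebra) (auto intro: z)
  then have W_M [measurable]: "random_variable K W"
    using W by (rule measurable_from_subalg)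
  have Z_Zt: "indep_var (Pi\<^sub>M {1..<t} (\<lambda>_. borel)) Z (Pi\<^sub>M {t} (\<lambda>_. borel)) Zt"
    unfolding Z_def Zt_def using t by (intro indep_var_restrict[OF indep]) auto
  have past_eq: "sets (past M z t) = {Z -` A \<inter> space M | A. A \<in> sets (Pi\<^sub>M {1..<t} (\<lambda>_. borel))}"
    unfolding past_def Z_def by (rule sets_vimage_algebra2) (auto simp: space_PiM)
  show ?thesis
  proof (rule pair_measure_eqI)
    fix A B assume "A \<in> sets (distr M K W)" "B \<in> sets (distr M borel (z t))"
    then have A [measurable]: "A \<in> sets K" and B [measurable]: "B \<in> sets borel"
      by auto
    obtain A' where A': "A' \<in> sets (Pi\<^sub>M {1..<t} (\<lambda>_. borel))" "W -` A \<inter> space M = Z -` A' \<inter> space M"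
      using measurable_sets[OF W A] unfolding past_eq by auto
    define B' where "B' = (\<lambda>p. p t) -` B \<inter> space (Pi\<^sub>M {t} (\<lambda>_. borel))"
    have B': "B' \<in> sets (Pi\<^sub>M {t} (\<lambda>_. borel))"
      unfolding B'_def using B by (intro measurable_sets[of _ _ borel] measurable_component_singleton) auto
    have B'_eq: "Zt -` B' \<inter> space M = z t -` B \<inter> space M"
      by (auto simp: Zt_def B'_def space_PiM)
    have "prob ((W -` A \<inter> space M) \<inter> (z t -` B \<inter> space M)) = prob ((\<lambda>\<omega>. (Z \<omega>, Zt \<omega>)) -` (A' \<times> B') \<inter> space M)"
      unfolding A' B'_eq[symmetric] by (intro arg_cong[of _ _ prob]) auto
    also have "\<dots> = prob (W -` A \<inter> space M) * prob (z t -` B \<inter> space M)"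
      unfolding A' B'_eq[symmetric] by (rule indep_varD[OF Z_Zt A'(1) B'])
    finally have "prob ((\<lambda>\<omega>. (W \<omega>, z t \<omega>)) -` (A \<times> B) \<inter> space M)
        = prob (W -` A \<inter> space M) * prob (z t -` B \<inter> space M)"
      by (simp add: vimage_Times Int_ac comp_def)
    then show "emeasure (distr M K W) A * emeasure (distr M borel (z t)) B
        = emeasure (distr M (K \<Otimes>\<^sub>M borel) (\<lambda>\<omega>. (W \<omega>, z t \<omega>))) (A \<times> B)"
      by (simp add: emeasure_distr emeasure_eq_measure ennreal_mult[symmetric])
  qed (auto intro!: prob_space_imp_sigma_finite prob_space_distr sets_pair_measure_cong)
qed

text \<open>Plays the part of conditioning on the past: under the product law, Fubini integrates out
  the fresh sample while \<open>W\<close> is frozen.\<close>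

lemma (in prob_space) expectation_product_le:
  fixes h :: "'b \<times> 'c \<Rightarrow> real"
  assumes [measurable]: "random_variable K W" "random_variable L Z"
    and dist: "distr M K W \<Otimes>\<^sub>M distr M L Z = distr M (K \<Otimes>\<^sub>M L) (\<lambda>\<omega>. (W \<omega>, Z \<omega>))"
    and h [measurable]: "h \<in> borel_measurable (K \<Otimes>\<^sub>M L)"
    and int_h: "integrable M (\<lambda>\<omega>. h (W \<omega>, Z \<omega>))" and int_k: "integrable M k"
    and le: "AE \<omega> in M. (\<integral>z. h (W \<omega>, z) \<partial>distr M L Z) \<le> k \<omega>"
  shows "expectation (\<lambda>\<omega>. h (W \<omega>, Z \<omega>)) \<le> expectation k"
proof -
  interpret W: prob_space "distr M K W" by (rule prob_space_distr) simp
  interpret Z: prob_space "distr M L Z" by (rule prob_space_distr) simp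
  interpret pair_sigma_finite "distr M K W" "distr M L Z" ..
  have int: "integrable (distr M K W \<Otimes>\<^sub>M distr M L Z) h"
    unfolding dist using int_h by (simp add: integrable_distr_eq)
  have inner: "(\<lambda>p. \<integral>z. h (p, z) \<partial>distr M L Z) \<in> borel_measurable K"
    by measurable
  have "expectation (\<lambda>\<omega>. h (W \<omega>, Z \<omega>)) = integral\<^sup>L (distr M (K \<Otimes>\<^sub>M L) (\<lambda>\<omega>. (W \<omega>, Z \<omega>))) h"
    by (simp add: integral_distr)
  also have "\<dots> = (\<integral>p. (\<integral>z. h (p, z) \<partial>distr M L Z) \<partial>distr M K W)"
    unfolding dist[symmetric] using integral_fst'[OF int] by simp
  also have "\<dots> = expectation (\<lambda>\<omega>. \<integral>z. h (W \<omega>, z) \<partial>distr M L Z)"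
    using inner by (simp add: integral_distr)
  also have "\<dots> \<le> expectation k"
  proof (rule integral_mono_AE[OF _ int_k le])
    show "integrable M (\<lambda>\<omega>. \<integral>z. h (W \<omega>, z) \<partial>distr M L Z)"
      using integrable_fst'[OF int] inner by (simp add: integrable_distr_eq)
  qed
  finally show ?thesis .
qed

section \<open>Convergence of the algorithm\<close>

theorem theorem1:
  fixes d :: nat
    and S :: "monomial set"
    and mon :: "'s::finite \<Rightarrow> monomial"
    and \<D> :: "((real ^ 's) \<times> real) measure"
    and loss loss' loss'' :: "real \<Rightarrow> real"
    and lam X D :: real
    and s \<tau> :: "nat \<Rightarrow> nat"
    and \<eta> :: "nat \<Rightarrow> real"
    and M :: "'w measure"
    and x :: "nat \<Rightarrow> 'w \<Rightarrow> real ^ 's"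
    and y :: "nat \<Rightarrow> 'w \<Rightarrow> real"
    and \<sigma> :: "nat \<Rightarrow> 'w \<Rightarrow> 's apple_state"
    and w g u :: "nat \<Rightarrow> 'w \<Rightarrow> real ^ 's"
    and f :: "real ^ 's \<Rightarrow> real"
    and T :: nat
  assumes S_monomials: "\<forall>m\<in>S. set_mset m \<subseteq> {1..d}"
    and coordinates: "bij_betw mon UNIV S"
    and distr_prob: "prob_space \<D>" "sets \<D> = sets borel"
    and distr_monomials: "AE (xv, yv) in \<D>. \<exists>b. \<forall>i. xv $ i = monomial_value b (mon i)"
    and loss_deriv: "\<And>z. (loss has_real_derivative loss' z) (at z)"
    and loss_deriv2: "\<And>z. (loss' has_real_derivative loss'' z) (at z)"
    and loss_convex: "convex_on UNIV loss"
    and loss_nonneg: "\<And>z. loss z \<ge> 0"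
    and loss_bounds: "\<And>z. max \<bar>loss' z\<bar> (loss'' z) \<le> 1"
    and lam_pos: "lam > 0"
    and f_eq: "f = objective \<D> loss lam"
    and schedule: "strict_mono_on {1..} \<tau>" "\<tau> 1 \<ge> 1"
    and step_sizes: "\<And>t. t \<ge> 1 \<Longrightarrow> \<eta> t = 1 / (lam * (real t + 1))"
    and M_prob: "prob_space M"
    and samples_indep: "prob_space.indep_vars M (\<lambda>_. borel) (\<lambda>t \<omega>. (x t \<omega>, y t \<omega>)) {1..}"
    and samples_distr: "\<And>t. t \<ge> 1 \<Longrightarrow> distr M borel (\<lambda>\<omega>. (x t \<omega>, y t \<omega>)) = \<D>"
    and init: "\<And>\<omega>. \<omega> \<in> space M \<Longrightarrow> \<sigma> 1 \<omega> = apple_init d"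
    and step: "\<And>t \<omega>. t \<ge> 1 \<Longrightarrow> \<omega> \<in> space M \<Longrightarrow>
                 apple_step mon d s \<tau> \<eta> t (g t \<omega>) (\<sigma> t \<omega>) (\<sigma> (t + 1) \<omega>)"
    and w_eq: "\<And>t \<omega>. t \<ge> 1 \<Longrightarrow> \<omega> \<in> space M \<Longrightarrow> w t \<omega> = weights (\<sigma> t \<omega>)"
    and g_eq: "\<And>t \<omega>. t \<ge> 1 \<Longrightarrow> \<omega> \<in> space M \<Longrightarrow>
                 g t \<omega> = loss' (w t \<omega> \<bullet> (y t \<omega> *\<^sub>R x t \<omega>)) *\<^sub>R (y t \<omega> *\<^sub>R x t \<omega>) + lam *\<^sub>R w t \<omega>"
    and features_in_S: "\<And>t \<omega>. t \<ge> 1 \<Longrightarrow> \<omega> \<in> space M \<Longrightarrow> features (\<sigma> t \<omega>) \<subseteq> S"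
    and features_past: "\<And>t. t \<ge> 1 \<Longrightarrow>
          (\<lambda>\<omega>. features (\<sigma> t \<omega>)) \<in> past M (\<lambda>t \<omega>. (x t \<omega>, y t \<omega>)) t \<rightarrow>\<^sub>M count_space UNIV"
    and X_bound: "AE \<omega> in M. \<forall>t\<ge>1. norm (y t \<omega> *\<^sub>R x t \<omega>) \<le> X"
    and u_measurable: "\<And>t. t \<ge> 1 \<Longrightarrow> u t \<in> borel_measurable M"
    and u_supported: "\<And>t \<omega>. t \<ge> 1 \<Longrightarrow> \<omega> \<in> space M \<Longrightarrow> supported_on mon (features (\<sigma> t \<omega>)) (u t \<omega>)"
    and D_bound: "AE \<omega> in M. \<forall>t\<ge>1. max (norm (w t \<omega>)) (norm (u t \<omega>)) \<le> D"
    and T_pos: "T \<ge> 1"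
  shows "(\<integral>\<omega>. f (w (T + 1) \<omega>)
             - (\<Sum>t=1..T. real (t + 2) * f (u t \<omega>)) / (\<Sum>t=1..T. real (t + 2)) \<partial>M)
         \<le> 1 / real (T + 1) * ((X\<^sup>2 + lam) * (X + lam * D)\<^sup>2 / (2 * lam\<^sup>2))"
proof -

  \<comment> \<open>Instantiation of the regularized risk\<close>
  interpret M: prob_space M by fact
  define z where "z = (\<lambda>t \<omega>. (x t \<omega>, y t \<omega>))"
  define V where "V = (\<lambda>p :: (real ^ 's) \<times> real. snd p *\<^sub>R fst p)"
  have V_borel [measurable]: "V \<in> borel_measurable borel"
    unfolding V_def by (intro borel_measurable_continuous_onI continuous_intros)
  have z_measurable [measurable]: "z t \<in> M \<rightarrow>\<^sub>M borel" if "t \<ge> 1" for t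
    using samples_indep that unfolding z_def M.indep_vars_def by auto
  have z_distr: "distr M borel (z t) = \<D>" if "t \<ge> 1" for t
    using samples_distr[OF that] by (simp add: z_def)
  \<comment> \<open>The bound is assumed along the sample process; the law of the first sample
    carries it over to \<open>\<D>\<close>.\<close>
  have V_bound: "AE p in \<D>. norm (V p) \<le> X"
  proof -
    have "AE \<omega> in M. norm (V (z 1 \<omega>)) \<le> X"
      using X_bound by eventually_elim (simp add: V_def z_def)
    then have "AE p in distr M borel (z 1). norm (V p) \<le> X"
      by (subst AE_distr_iff) auto
    then show ?thesis
      unfolding z_distr[OF order_refl] .
  qed
  interpret R: regularized_risk \<D> V loss loss' loss'' lam X
  proof (intro regularized_risk.intro regularized_risk_axioms.intro)
    show "V \<in> borel_measurable \<D>"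
      using V_borel measurable_cong_sets[OF distr_prob(2) refl] by blast
    show "\<bar>loss' r\<bar> \<le> 1" "loss'' r \<le> 1" for r
      using loss_bounds[of r] by auto
  qed (fact distr_prob V_bound loss_deriv loss_deriv2 loss_convex loss_nonneg lam_pos)+
  have f_risk: "f = R.risk"
    unfolding f_eq by (rule ext) (simp only: objective_def R.risk_def, simp add: V_def case_prod_unfold)
  have g_stoch: "g t \<omega> = R.stoch_grad (w t \<omega>) (z t \<omega>)" if "t \<ge> 1" "\<omega> \<in> space M" for t \<omega>
    using g_eq[OF that] unfolding R.stoch_grad_def by (simp add: V_def z_def)
  note [measurable] = R.risk_measurable R.loss'_measurable

  \<comment> \<open>Iterates, feature sets and adaptedness\<close>
  define F where "F t \<omega> = features (\<sigma> t \<omega>)" for t \<omega>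
  \<comment> \<open>The index set is used as a random element because it has only finitely many values, so that joint
    measurability can be checked one value at a time.\<close>
  define I where "I t \<omega> = mon -` F t \<omega>" for t \<omega>
  have w_step: "w (t + 1) \<omega> = w t \<omega> - \<eta> t *\<^sub>R restrict_vec mon (F t \<omega>) (R.stoch_grad (w t \<omega>) (z t \<omega>))"
    if "t \<ge> 1" "\<omega> \<in> space M" for t \<omega>
    using step[OF that] w_eq[OF that] w_eq[of "t + 1" \<omega>] g_stoch[OF that] that
    by (simp add: apple_step_def F_def)
  have F_mono: "F t \<omega> \<subseteq> F (t + 1) \<omega>" if "t \<ge> 1" "\<omega> \<in> space M" for t \<omega>
    unfolding F_def using step[OF that] by (rule apple_step_features_mono)
  have w_1: "w 1 \<omega> = 0" if "\<omega> \<in> space M" for \<omega>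
    using w_eq[of 1 \<omega>] init[OF that] that by (simp add: apple_init_def)
  \<comment> \<open>The one-round estimate compares \<open>w t \<omega>\<close> with an infimum over
    a subspace that must contain it.\<close>
  have w_supported: "supported_on mon (F t \<omega>) (w t \<omega>)" if "t \<ge> 1" "\<omega> \<in> space M" for t \<omega>
    using that(1)
  proof (induction t rule: nat_induct_at_least)
    case base
    show ?case
      using w_1 that by (simp add: supported_on_def)
  next
    case (Suc t)
    have "supported_on mon (F t \<omega>) (w (t + 1) \<omega>)"
      unfolding w_step[OF Suc(1) that(2)]
      by (intro supported_on_diff supported_on_scaleR supported_on_restrict_vec Suc)
    then show ?case
      using F_mono[OF Suc(1) that(2)] by (auto intro: supported_on_mono)
  qed

  have past_sub: "subalgebra M (past M z t)" for t
    by (rule past_subalgebra) auto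
  have past_Suc: "subalgebra (past M z (t + 1)) (past M z t)" for t
    by (rule past_subalgebra) (auto intro: past_measurable)
  have F_past: "F t \<in> past M z t \<rightarrow>\<^sub>M count_space UNIV" if "t \<ge> 1" for t
    using features_past[OF that] by (simp add: z_def F_def[abs_def])
  have I_past: "I t \<in> past M z t \<rightarrow>\<^sub>M count_space UNIV" if "t \<ge> 1" for t
    using measurable_compose[OF F_past[OF that], of "\<lambda>A. mon -` A"] by (simp add: I_def[abs_def])
  define K where "K = (borel :: (real ^ 's) measure) \<Otimes>\<^sub>M count_space (UNIV :: 's set set)"
  \<comment> \<open>The update as a deterministic function of the past pair (weights, index set) and
    the fresh sample, the form required by \<open>expectation_product_le\<close>.\<close>
  define upd where "upd t = (\<lambda>q :: ((real ^ 's) \<times> 's set) \<times> (real ^ 's) \<times> real.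
      fst (fst q) - \<eta> t *\<^sub>R restrict_vec mon (mon ` snd (fst q)) (R.stoch_grad (fst (fst q)) (snd q)))" for t
  have w_upd: "w (t + 1) \<omega> = upd t ((w t \<omega>, I t \<omega>), z t \<omega>)" if "t \<ge> 1" "\<omega> \<in> space M" for t \<omega>
    using w_step[OF that] by (simp add: upd_def I_def restrict_vec_Int_range)
  have upd_measurable [measurable]: "upd t \<in> borel_measurable (K \<Otimes>\<^sub>M borel)" for t
    unfolding upd_def K_def
  proof (rule measurable_compose_countable[where g = "\<lambda>q. snd (fst q)"])
    show "(\<lambda>q. fst (fst q) - \<eta> t *\<^sub>R restrict_vec mon (mon ` i) (R.stoch_grad (fst (fst q)) (snd q)))
        \<in> borel_measurable (((borel :: (real ^ 's) measure) \<Otimes>\<^sub>M count_space UNIV) \<Otimes>\<^sub>M borel)" for i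
      unfolding R.stoch_grad_def by measurable
  qed measurable
  \<comment> \<open>Adaptedness by induction: at time 1 the weights are constant, and afterwards
    \<open>upd\<close> uses only data that belong to the past of the next round.\<close>
  have w_past: "w t \<in> borel_measurable (past M z t)" if "t \<ge> 1" for t
    using that
  proof (induction t rule: nat_induct_at_least)
    case base
    show ?case
      using measurable_cong[of "past M z 1" "w 1" "\<lambda>_. 0" borel] w_1 by simp
  next
    case (Suc t)
    have [measurable]: "w t \<in> borel_measurable (past M z (t + 1))"
        "I t \<in> past M z (t + 1) \<rightarrow>\<^sub>M count_space UNIV" "z t \<in> borel_measurable (past M z (t + 1))"
      using Suc measurable_from_subalg[OF past_Suc] I_past past_measurable[of t "t + 1" z M] by auto
    have "(\<lambda>\<omega>. upd t ((w t \<omega>, I t \<omega>), z t \<omega>)) \<in> borel_measurable (past M z (t + 1))"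
      by (rule measurable_compose[OF _ upd_measurable]) (unfold K_def, measurable)
    then show ?case
      using measurable_cong[of "past M z (t + 1)" "w (t + 1)" "\<lambda>\<omega>. upd t ((w t \<omega>, I t \<omega>), z t \<omega>)" borel]
        w_upd[OF Suc(1)] by simp
  qed
  have w_measurable [measurable]: "w t \<in> borel_measurable M" if "t \<ge> 1" for t
    using measurable_from_subalg[OF past_sub w_past[OF that]] .
  have wI_past: "(\<lambda>\<omega>. (w t \<omega>, I t \<omega>)) \<in> past M z t \<rightarrow>\<^sub>M K" if "t \<ge> 1" for t
    unfolding K_def using w_past[OF that] I_past[OF that] by (rule measurable_Pair)
  have product: "distr M K (\<lambda>\<omega>. (w t \<omega>, I t \<omega>)) \<Otimes>\<^sub>M distr M borel (z t)
      = distr M (K \<Otimes>\<^sub>M borel) (\<lambda>\<omega>. ((w t \<omega>, I t \<omega>), z t \<omega>))" if "t \<ge> 1" for t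
    using samples_indep that wI_past[OF that] unfolding z_def[symmetric] by (rule M.past_present_distr)

  \<comment> \<open>Benchmarks and integrability\<close>
  define m where "m t \<omega> = R.constrained_min {v. supported_on mon (F t \<omega>) v}" for t \<omega>
  \<comment> \<open>The benchmark is a function of the feature set, and every function on a
    \<open>count_space\<close> is measurable.\<close>
  have m_measurable [measurable]: "m t \<in> borel_measurable M" if "t \<ge> 1" for t
    using measurable_compose[OF measurable_from_subalg[OF past_sub F_past[OF that]],
        of "\<lambda>A. R.constrained_min {v. supported_on mon A v}" borel]
    by (simp add: m_def[abs_def])
  have m_integrable: "integrable M (m t)" if "t \<ge> 1" for t
  proof (rule M.integrable_const_bound)
    show "AE \<omega> in M. norm (m t \<omega>) \<le> loss 0"
      unfolding m_def by (intro always_eventually allI R.constrained_min_bound) (simp add: supported_on_def)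
  qed (use that in simp)
  have f_integrable: "integrable M (\<lambda>\<omega>. f (v \<omega>))"
    if "v \<in> borel_measurable M" "AE \<omega> in M. norm (v \<omega>) \<le> D" for v
  proof (rule M.integrable_const_bound)
    show "AE \<omega> in M. norm (f (v \<omega>)) \<le> loss 0 + D * X + lam / 2 * D\<^sup>2"
      using that(2) unfolding f_risk by eventually_elim (rule R.risk_bound)
    show "(\<lambda>\<omega>. f (v \<omega>)) \<in> borel_measurable M"
      unfolding f_risk using that(1) by measurable
  qed
  have w_D: "AE \<omega> in M. norm (w t \<omega>) \<le> D" and u_D: "AE \<omega> in M. norm (u t \<omega>) \<le> D" if "t \<ge> 1" for t
    using D_bound by (eventually_elim, use that in simp)+
  have fw_integrable: "integrable M (\<lambda>\<omega>. f (w t \<omega>))"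
    and fu_integrable: "integrable M (\<lambda>\<omega>. f (u t \<omega>))" if "t \<ge> 1" for t
    using that by (auto intro!: f_integrable w_D u_D u_measurable)

  \<comment> \<open>Recursion for the expected risk\<close>
  define C where "C = (X\<^sup>2 + lam) * (X + lam * D)\<^sup>2 / (2 * lam\<^sup>2)"
  have C_nonneg: "C \<ge> 0"
    unfolding C_def using lam_pos by simp
  define a where "a t = (\<integral>\<omega>. f (w t \<omega>) \<partial>M)" for t
  define b where "b t = (\<integral>\<omega>. m t \<omega> \<partial>M)" for t
  have a_step: "a (t + 1) \<le> a t - 2 / (real t + 1) * (a t - b t) + C / (real t + 1)\<^sup>2" if t: "t \<ge> 1" for t
  proof -
    have eta: "\<eta> t = 1 / (lam * (real t + 1))" "\<eta> t \<ge> 0"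
      using step_sizes[OF t] lam_pos by auto
    define k where "k \<omega> = f (w t \<omega>) - 2 * lam * \<eta> t * (f (w t \<omega>) - m t \<omega>)
        + (X\<^sup>2 + lam) / 2 * (\<eta> t)\<^sup>2 * (X + lam * D)\<^sup>2" for \<omega>
    have f_upd: "f (w (t + 1) \<omega>) = R.risk (upd t ((w t \<omega>, I t \<omega>), z t \<omega>))" if "\<omega> \<in> space M" for \<omega>
      using w_upd[OF t that] by (simp add: f_risk)
    have "a (t + 1) = (\<integral>\<omega>. R.risk (upd t ((w t \<omega>, I t \<omega>), z t \<omega>)) \<partial>M)"
      unfolding a_def by (intro Bochner_Integration.integral_cong refl f_upd)
    also have "\<dots> \<le> (\<integral>\<omega>. k \<omega> \<partial>M)"
    proof (rule M.expectation_product_le[OF _ _ product[OF t], of "\<lambda>q. R.risk (upd t q)"])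
      show "integrable M (\<lambda>\<omega>. R.risk (upd t ((w t \<omega>, I t \<omega>), z t \<omega>)))"
        by (rule Bochner_Integration.integrable_cong[OF refl f_upd, THEN iffD1]) (use fw_integrable in auto)
      show "integrable M k"
        unfolding k_def[abs_def] using fw_integrable[OF t] m_integrable[OF t] by simp
      \<comment> \<open>With \<open>\<omega>\<close> fixed, weights and features are constants and
        only the fresh sample is integrated. The radius \<open>D\<close> is available only almost
        surely.\<close>
      show "AE \<omega> in M. (\<integral>p. R.risk (upd t ((w t \<omega>, I t \<omega>), p)) \<partial>distr M borel (z t)) \<le> k \<omega>"
        using w_D[OF t] AE_space
      proof eventually_elim
        case (elim \<omega>)
        have "(\<integral>p. R.risk (w t \<omega> - \<eta> t *\<^sub>R restrict_vec mon (F t \<omega>) (R.stoch_grad (w t \<omega>) p)) \<partial>\<D>) \<le> k \<omega>"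
          unfolding k_def m_def f_risk
          by (rule R.projected_step)
            (use elim eta(2) w_supported[OF t] in
              \<open>auto intro: restrict_vec_bounded_linear restrict_vec_inner supported_on_restrict_vec
                restrict_vec_supported norm_restrict_vec_le supported_on_diff\<close>)
        then show ?case
          by (simp add: upd_def I_def restrict_vec_Int_range z_distr[OF t])
      qed
    qed (use measurable_from_subalg[OF past_sub wI_past[OF t]] t in auto)
    also have "\<dots> = a t - 2 * lam * \<eta> t * (a t - b t) + (X\<^sup>2 + lam) / 2 * (\<eta> t)\<^sup>2 * (X + lam * D)\<^sup>2"
      unfolding k_def a_def b_def using fw_integrable[OF t] m_integrable[OF t]
      by (simp add: M.prob_space)
    \<comment> \<open>The step size gives exactly the contraction that the recursion lemma expects,
      and its square turns the noise term into \<open>C / (real t + 1)\<^sup>2\<close>.\<close>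
    also have "2 * lam * \<eta> t = 2 / (real t + 1)"
      using lam_pos by (simp add: eta)
    also have "(X\<^sup>2 + lam) / 2 * (\<eta> t)\<^sup>2 * (X + lam * D)\<^sup>2 = C / (real t + 1)\<^sup>2"
      by (simp add: C_def eta power_divide power_mult_distrib)
    finally show ?thesis .
  qed
  have b_decreasing: "b (t + 1) \<le> b t" if t: "t \<ge> 1" for t
    unfolding b_def
  proof (rule integral_mono)
    show "m (t + 1) \<omega> \<le> m t \<omega>" if "\<omega> \<in> space M" for \<omega>
      unfolding m_def
    proof (rule R.constrained_min_antimono)
      show "{v. supported_on mon (F t \<omega>) v} \<subseteq> {v. supported_on mon (F (t + 1) \<omega>) v}"
        using F_mono[OF t that] by (auto intro: supported_on_mono)
      have "supported_on mon (F t \<omega>) 0"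
        by (simp add: supported_on_def)
      then show "{v. supported_on mon (F t \<omega>) v} \<noteq> {}"
        by blast
    qed
  qed (use m_integrable t in auto)
  have b_le: "b t \<le> (\<integral>\<omega>. f (u t \<omega>) \<partial>M)" if t: "t \<ge> 1" for t
    unfolding b_def
  proof (rule integral_mono)
    show "m t \<omega> \<le> f (u t \<omega>)" if "\<omega> \<in> space M" for \<omega>
      unfolding m_def f_risk using u_supported[OF t that] by (intro R.constrained_min_le) (simp add: F_def)
  qed (use m_integrable fu_integrable t in auto)

  \<comment> \<open>Weighted averaging over the rounds\<close>
  let ?W = "\<Sum>t=1..T. real (t + 2)"
  have T: "real T > 0"
    using T_pos by simp
  have "a (T + 1) * (real T * (real T + 1)) \<le> 2 * (\<Sum>t=1..T. real t * b t) + C * real T"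
    using weighted_recursion_bound[of a b C T] a_step C_nonneg by (simp add: mult_ac)
  then have "a (T + 1) \<le> (2 * (\<Sum>t=1..T. real t * b t) + C * real T) / (real T * (real T + 1))"
    using T by (subst pos_le_divide_eq) auto
  \<comment> \<open>The accumulated noise \<open>C * real T\<close>, divided by
    \<open>real T * (real T + 1)\<close>, leaves the claimed rate.\<close>
  also have "\<dots> = 2 * (\<Sum>t=1..T. real t * b t) / (real T * (real T + 1)) + C / (real T + 1)"
    using T by (simp add: add_divide_distrib)
  also have "2 * (\<Sum>t=1..T. real t * b t) / (real T * (real T + 1))
      \<le> (\<Sum>t=1..T. real (t + 2) * b t) / ?W"
    by (rule weighted_average_shift) (use b_decreasing T_pos in auto)
  also have "\<dots> \<le> (\<Sum>t=1..T. real (t + 2) * (\<integral>\<omega>. f (u t \<omega>) \<partial>M)) / ?W"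
    by (intro divide_right_mono sum_mono mult_left_mono b_le sum_nonneg) auto
  finally have "a (T + 1) - (\<Sum>t=1..T. real (t + 2) * (\<integral>\<omega>. f (u t \<omega>) \<partial>M)) / ?W \<le> C / (real T + 1)"
    by simp
  moreover have "(\<integral>\<omega>. f (w (T + 1) \<omega>) - (\<Sum>t=1..T. real (t + 2) * f (u t \<omega>)) / ?W \<partial>M)
      = a (T + 1) - (\<Sum>t=1..T. real (t + 2) * (\<integral>\<omega>. f (u t \<omega>) \<partial>M)) / ?W"
  proof -
    have "integrable M (\<lambda>\<omega>. \<Sum>t=1..T. real (t + 2) * f (u t \<omega>))"
      using fu_integrable by (intro Bochner_Integration.integrable_sum) auto
    moreover have "(\<integral>\<omega>. (\<Sum>t=1..T. real (t + 2) * f (u t \<omega>)) \<partial>M)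
        = (\<Sum>t=1..T. real (t + 2) * (\<integral>\<omega>. f (u t \<omega>) \<partial>M))"
      using fu_integrable by (subst Bochner_Integration.integral_sum) auto
    ultimately show ?thesis
      unfolding a_def using fw_integrable[of "T + 1"]
      by (subst Bochner_Integration.integral_diff) auto
  qed
  ultimately show ?thesis
    unfolding C_def by (simp add: add.commute mult.commute)
qed

end
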